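(* Let $G$ be a weighted digraph on $V=\{1,\dots,n\}$ with random walk Laplacian $\mathcal{L}=I-S$ and with exactly $k$ reaches $R_1,\dots,R_k$. Let $\{\gamma_m\}_{m=1}^k$ (columns) and $\{\bar\gamma_m\}_{m=1}^k$ (rows) be the bases of the right and left kernels of $\mathcal{L}$ described in the context. Let $p^{(0)}$ be an initial probability vector (a row vector with nonnegative entries summing to $1$). Then $$\lim_{\ell\to\infty}\frac1\ell\sum_{i=0}^{\ell-1}p^{(0)}S^i=\sum_{m=1}^k\left(p^{(0)}\gamma_m\right)\bar\gamma_m,$$ where $p^{(0)}\gamma_m$ is a scalar.
   Context: $G$ is a weakly connected (i.e. its underlying undirected graph is connected) weighted directed graph on $V=\{1,\dots,n\}$ with directed edge set $E\subseteq V\times V$; $ji\in E$ denotes an edge $j\to i$, carrying a weight $w_{ji}>0$. The adjacency matrix $Q$ has $Q_{ij}=w_{ji}$ if $ji\in E$ and $0$ otherwise; if row $i$ of $Q$ is zero, $Q_{ii}$ is replaced by $1$ (the result is still called $Q$). $D$ is the diagonal matrix with $D_{ii}=\sum_j Q_{ij}$, $S=D^{-1}Q$ (row stochastic), and $\mathcal{L}=I-S$ is the random walk Laplacian. The random walk on $G$ is $p^{(\ell+1)}=p^{(\ell)}S$. Write $j\rightsquigarrow i$ if there is a directed path from $j$ to $i$. The reachable set of $j$ is $R(j)=\{j\}\cup\{i: j\rightsquigarrow i\}$. A reach is a set of the form $R(j)$ that is maximal with respect to inclusion among all reachable sets. The distinct reaches are $R_1,\dots,R_k$; the exclusive part of $R_i$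 is $H_i=R_i\setminus\bigcup_{j\ne i}R_j$, the common part is $C_i=R_i\setminus H_i$, and the cabal $B_i$ of $R_i$ is the set of its roots, i.e. of vertices $r\in R_i$ with $R(r)=R_i$. $\gamma_1,\dots,\gamma_k$ is the basis of the right kernel $\{x:\mathcal{L}x=0\}$ (column vectors; the kernel is known to have dimension $k$ and to possess such a basis) satisfying: $\gamma_i(v)=1$ for $v\in H_i$; $\gamma_i(v)\in(0,1)$ for $v\in C_i$; $\gamma_i(v)=0$ for $v\notin R_i$; $\sum_i\gamma_i$ is the all-ones vector. $\bar\gamma_1,\dots,\bar\gamma_k$ is the basis of the left kernel $\{p: p\mathcal{L}=0\}$ (row vectors) satisfying: $\bar\gamma_i(v)\ge0$ for all $v$; the support of $\bar\gamma_i$ is $B_i$; $\sum_v\bar\gamma_i(v)=1$. *)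

theory Defs
  imports "HOL-Analysis.Analysis"
begin

text \<open>
  The vertices are the elements of a finite type. A pair \<open>(j, i) \<in> E\<close> is the edge
  from \<open>j\<close> to \<open>i\<close>, and its weight is \<open>w j i\<close>; the values of \<open>w\<close> off \<open>E\<close> are irrelevant.
\<close>

definition weakly_connected :: "('n \<times> 'n) set \<Rightarrow> bool" where
  "weakly_connected E \<longleftrightarrow> (\<forall>u v. (u, v) \<in> (E \<union> E\<inverse>)\<^sup>*)"

locale weighted_digraph =
  fixes E :: "('n::finite \<times> 'n) set" and w :: "'n \<Rightarrow> 'n \<Rightarrow> real"
  assumes weight_pos: "(j, i) \<in> E \<Longrightarrow> w j i > 0"
    and connected: "weakly_connected E"

text \<open>Row \<open>i\<close> of the adjacency matrix collects the edges that end in \<open>i\<close>.\<close>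

definition raw_adjacency :: "('n::finite \<times> 'n) set \<Rightarrow> ('n \<Rightarrow> 'n \<Rightarrow> real) \<Rightarrow> real^'n^'n" where
  "raw_adjacency E w = (\<chi> i j. if (j, i) \<in> E then w j i else 0)"

definition adjacency :: "('n::finite \<times> 'n) set \<Rightarrow> ('n \<Rightarrow> 'n \<Rightarrow> real) \<Rightarrow> real^'n^'n" where
  "adjacency E w =
     (\<chi> i j. if j = i \<and> raw_adjacency E w $ i = 0 then 1 else raw_adjacency E w $ i $ j)"

definition degree_matrix :: "('n::finite \<times> 'n) set \<Rightarrow> ('n \<Rightarrow> 'n \<Rightarrow> real) \<Rightarrow> real^'n^'n" where
  "degree_matrix E w = (\<chi> i j. if i = j then \<Sum>v\<in>UNIV. adjacency E w $ i $ v else 0)"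

definition transition_matrix :: "('n::finite \<times> 'n) set \<Rightarrow> ('n \<Rightarrow> 'n \<Rightarrow> real) \<Rightarrow> real^'n^'n" where
  "transition_matrix E w = matrix_inv (degree_matrix E w) ** adjacency E w"

definition rw_laplacian :: "('n::finite \<times> 'n) set \<Rightarrow> ('n \<Rightarrow> 'n \<Rightarrow> real) \<Rightarrow> real^'n^'n" where
  "rw_laplacian E w = mat 1 - transition_matrix E w"

text \<open>
  The library's multiplication (hence its power operation) on the type \<open>real^'n^'n\<close> is
  componentwise, so the matrix power has to be defined separately.
\<close>

primrec mat_pow :: "real^'n^'n \<Rightarrow> nat \<Rightarrow> real^'n^'n" where
  "mat_pow A 0 = mat 1"
| "mat_pow A (Suc l) = mat_pow A l ** A"

definition reachable_set :: "('n \<times> 'n) set \<Rightarrow> 'n \<Rightarrow> 'n set" where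
  "reachable_set E j = {j} \<union> {i. (j, i) \<in> E\<^sup>+}"

definition reaches :: "('n \<times> 'n) set \<Rightarrow> 'n set set" where
  "reaches E = {X \<in> range (reachable_set E). \<forall>Y \<in> range (reachable_set E). X \<subseteq> Y \<longrightarrow> X = Y}"

definition exclusive_part :: "('n \<times> 'n) set \<Rightarrow> 'n set \<Rightarrow> 'n set" where
  "exclusive_part E X = X - \<Union>(reaches E - {X})"

definition common_part :: "('n \<times> 'n) set \<Rightarrow> 'n set \<Rightarrow> 'n set" where
  "common_part E X = X - exclusive_part E X"

definition cabal :: "('n \<times> 'n) set \<Rightarrow> 'n set \<Rightarrow> 'n set" where
  "cabal E X = {r \<in> X. reachable_set E r = X}"

definition basis_family :: "nat \<Rightarrow> (nat \<Rightarrow> 'v::real_vector) \<Rightarrow> 'v set \<Rightarrow> bool" where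
  "basis_family k b W \<longleftrightarrow>
     inj_on b {1..k} \<and> independent (b ` {1..k}) \<and> span (b ` {1..k}) = W"

text \<open>Below, \<open>R 1, \<dots>, R k\<close> enumerates the reaches of \<open>E\<close> without repetition.\<close>

definition right_kernel_basis ::
  "('n::finite \<times> 'n) set \<Rightarrow> ('n \<Rightarrow> 'n \<Rightarrow> real) \<Rightarrow> nat \<Rightarrow> (nat \<Rightarrow> 'n set) \<Rightarrow> (nat \<Rightarrow> real^'n) \<Rightarrow> bool"
  where
  "right_kernel_basis E w k R \<gamma> \<longleftrightarrow>
     basis_family k \<gamma> {x. rw_laplacian E w *v x = 0} \<and>
     (\<forall>m\<in>{1..k}.
        (\<forall>v\<in>exclusive_part E (R m). \<gamma> m $ v = 1) \<and>
        (\<forall>v\<in>common_part E (R m). 0 < \<gamma> m $ v \<and> \<gamma> m $ v < 1) \<and>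
        (\<forall>v. v \<notin> R m \<longrightarrow> \<gamma> m $ v = 0)) \<and>
     (\<forall>v. (\<Sum>m=1..k. \<gamma> m $ v) = 1)"

definition left_kernel_basis ::
  "('n::finite \<times> 'n) set \<Rightarrow> ('n \<Rightarrow> 'n \<Rightarrow> real) \<Rightarrow> nat \<Rightarrow> (nat \<Rightarrow> 'n set) \<Rightarrow> (nat \<Rightarrow> real^'n) \<Rightarrow> bool"
  where
  "left_kernel_basis E w k R \<gamma>' \<longleftrightarrow>
     basis_family k \<gamma>' {p. p v* rw_laplacian E w = 0} \<and>
     (\<forall>m\<in>{1..k}.
        (\<forall>v. \<gamma>' m $ v \<ge> 0) \<and>
        {v. \<gamma>' m $ v \<noteq> 0} = cabal E (R m) \<and>
        (\<Sum>v\<in>UNIV. \<gamma>' m $ v) = 1)"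

end

theory Submission
  imports Defs
begin

text \<open>
  Write \<open>S\<close> for the transition matrix, \<open>L = I - S\<close>, and \<open>q = \<Sum>\<^sub>m (p\<^sub>0 \<bullet> \<gamma>\<^sub>m) \<gamma>'\<^sub>m\<close> for the
  claimed limit. The proof is the mean ergodic theorem in finite dimension, followed by the
  identification of the ergodic projection.

  The two kernel bases are biorthogonal, \<open>\<gamma>'\<^sub>m \<bullet> \<gamma>\<^sub>j = \<delta>\<^bsub>mj\<^esub>\<close>, for a purely combinatorial reason
  (\<open>root_in_unique_reach\<close>): a root of a reach lies in no other reach, so on the support
  of \<open>\<gamma>'\<^sub>m\<close> the vector \<open>\<gamma>\<^sub>m\<close> is constantly \<open>1\<close> and every other \<open>\<gamma>\<^sub>j\<close> vanishes. Hence
  \<open>p\<^sub>0 - q\<close> is orthogonal to every \<open>\<gamma>\<^sub>j\<close>, that is, to the whole right kernel of \<open>L\<close>. By the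
  Fredholm alternative \<open>p\<^sub>0 - q\<close> therefore lies in the row space of \<open>L\<close>:
  \<open>p\<^sub>0 - q = y - yS\<close> for some row vector \<open>y\<close>.

  Since \<open>qS = q\<close>, the sum of the first \<open>l\<close> iterates \<open>p\<^sub>0S\<^sup>i\<close> is \<open>l q + (y - yS\<^sup>l)\<close> by telescoping.
  As \<open>S\<close> is row stochastic it does not increase the \<open>\<ell>\<^sup>1\<close> norm of row vectors, so the remainder
  stays bounded, and after division by \<open>l\<close> it tends to zero at rate \<open>O(1/l)\<close>.
\<close>

section \<open>Cesaro means of the powers of a row stochastic matrix\<close>

definition row_stochastic :: "real^'n^'n \<Rightarrow> bool" where
  "row_stochastic A \<longleftrightarrow> (\<forall>i j. 0 \<le> A $ i $ j) \<and> (\<forall>i. (\<Sum>j\<in>UNIV. A $ i $ j) = 1)"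

lemma row_stochastic_l1_contraction:
  assumes "row_stochastic A"
  shows "(\<Sum>j\<in>UNIV. \<bar>(x v* A) $ j\<bar>) \<le> (\<Sum>i\<in>UNIV. \<bar>x $ i\<bar>)"
proof -
  have nn: "0 \<le> A $ i $ j" and row: "(\<Sum>j\<in>UNIV. A $ i $ j) = 1" for i j
    using assms by (auto simp: row_stochastic_def)
  have "(\<Sum>j\<in>UNIV. \<bar>(x v* A) $ j\<bar>) \<le> (\<Sum>j\<in>UNIV. \<Sum>i\<in>UNIV. A $ i $ j * \<bar>x $ i\<bar>)"
    unfolding vector_matrix_mult_def
    by (intro sum_mono) (auto intro!: order_trans[OF sum_abs] simp: abs_mult nn mult.commute)
  also have "\<dots> = (\<Sum>i\<in>UNIV. (\<Sum>j\<in>UNIV. A $ i $ j) * \<bar>x $ i\<bar>)"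
    by (subst sum.swap) (simp add: sum_distrib_right)
  finally show ?thesis
    by (simp add: row)
qed

lemma row_stochastic_mat_pow_norm_bound:
  assumes "row_stochastic A"
  shows "norm (x v* mat_pow A l) \<le> (\<Sum>i\<in>UNIV. \<bar>x $ i\<bar>)"
proof -
  have "(\<Sum>j\<in>UNIV. \<bar>(x v* mat_pow A l) $ j\<bar>) \<le> (\<Sum>i\<in>UNIV. \<bar>x $ i\<bar>)"
  proof (induction l)
    case (Suc l)
    have "x v* mat_pow A (Suc l) = (x v* mat_pow A l) v* A"
      by (simp add: vector_matrix_mul_assoc)
    with Suc row_stochastic_l1_contraction[OF assms, of "x v* mat_pow A l"] show ?case
      by simp
  qed simp
  then show ?thesis
    using norm_le_l1_cart order_trans by blast
qed

lemma left_fixed_vector_mat_pow: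
  assumes "q v* A = q"
  shows "q v* mat_pow A i = q"
proof (induction i)
  case (Suc i)
  then show ?case
    by (metis assms mat_pow.simps(2) vector_matrix_mul_assoc)
qed simp

text \<open>
  The starting vector is a stationary part \<open>q\<close> plus a coboundary \<open>y - yA\<close>. The coboundary
  telescopes along the orbit, so its contribution to the sum of the iterates stays bounded.
\<close>

lemma cesaro_mean_tendsto_stationary_part:
  fixes A :: "real^'n^'n"
  assumes A: "row_stochastic A"
    and q: "q v* A = q"
    and p: "p = q + (y - y v* A)"
  shows "(\<lambda>l. (1 / real l) *\<^sub>R (\<Sum>i<l. p v* mat_pow A i)) \<longlonglongrightarrow> q"
proof -
  define z where "z l = y - y v* mat_pow A l" for l
  have Suc_left: "(y v* A) v* mat_pow A i = y v* mat_pow A (Suc i)" for i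
    by (induction i) (simp_all flip: vector_matrix_mul_assoc)
  have iterate: "p v* mat_pow A i = q + (y v* mat_pow A i - y v* mat_pow A (Suc i))" for i
    unfolding p vector_matrix_left_distrib vector_matrix_mult_diff_distrib Suc_left
    by (simp add: left_fixed_vector_mat_pow[OF q])
  have orbit_sum: "(\<Sum>i<l. p v* mat_pow A i) = real l *\<^sub>R q + z l" for l
    unfolding iterate sum.distrib z_def sum_lessThan_telescope'[of "\<lambda>i. y v* mat_pow A i"]
    by (simp add: sum_constant_scaleR del: sum_constant)
  have "norm (z l) \<le> norm y + (\<Sum>i\<in>UNIV. \<bar>y $ i\<bar>)" for l
    unfolding z_def
    using norm_triangle_ineq4[of y "y v* mat_pow A l"] row_stochastic_mat_pow_norm_bound[OF A, of y l]
    by linarith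
  then have "Bfun z sequentially"
    by (intro BfunI[where K = "norm y + (\<Sum>i\<in>UNIV. \<bar>y $ i\<bar>)"] always_eventually) auto
  moreover have "Zfun (\<lambda>l. 1 / real l) sequentially"
    using lim_1_over_n[where 'a = real] by (simp add: tendsto_Zfun_iff)
  ultimately have "(\<lambda>l. (1 / real l) *\<^sub>R z l) \<longlonglongrightarrow> 0"
    using bounded_bilinear.Zfun_prod_Bfun[OF bounded_bilinear_scaleR]
    by (simp add: tendsto_Zfun_iff)
  then have "(\<lambda>l. q + (1 / real l) *\<^sub>R z l) \<longlonglongrightarrow> q"
    using tendsto_add[OF tendsto_const] by fastforce
  then show ?thesis
    \<comment> \<open>At \<open>l = 0\<close> the mean is \<open>0\<close>, not \<open>q\<close>, so the two sequences agree only eventually.\<close>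
  proof (rule Lim_transform_eventually)
    show "\<forall>\<^sub>F l in sequentially.
        q + (1 / real l) *\<^sub>R z l = (1 / real l) *\<^sub>R (\<Sum>i<l. p v* mat_pow A i)"
      using eventually_gt_at_top[of 0]
      by eventually_elim (simp add: orbit_sum scaleR_add_right)
  qed
qed

text \<open>
  This is the Fredholm alternative: the orthogonal complement of the row space is the right
  kernel, and a finite-dimensional subspace is its own double complement.
\<close>

lemma orthogonal_right_kernel_in_row_space:
  fixes A :: "real^'n^'m"
  assumes "\<And>x. A *v x = 0 \<Longrightarrow> u \<bullet> x = 0"
  obtains y where "u = y v* A"
proof -
  let ?W = "range (\<lambda>y. y v* A)"
  have "subspace ?W"
    using linear_subspace_image[OF matrix_vector_mul_linear[of "transpose A"] subspace_UNIV] by simp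
  moreover have "u \<in> ?W\<^sup>\<bottom>\<^sup>\<bottom>"
  proof -
    have "A *v x = 0" if "x \<in> ?W\<^sup>\<bottom>" for x
      using that by (simp add: orthogonal_comp_def orthogonal_def dot_lmul_matrix vector_eq_rdot)
        (metis inner_eq_zero_iff)
    then show ?thesis
      using assms by (auto simp: orthogonal_comp_def orthogonal_def inner_commute)
  qed
  ultimately show ?thesis
    using that orthogonal_comp_self by blast
qed

section \<open>The transition matrix of a weighted digraph\<close>

lemma matrix_inv_eqI:
  fixes A B :: "real^'n^'n"
  assumes "A ** B = mat 1"
  shows "matrix_inv A = B"
proof -
  have "B ** A = mat 1"
    using assms matrix_left_right_inverse by blast
  with assms have "A ** matrix_inv A = mat 1 \<and> matrix_inv A ** A = mat 1"
    unfolding matrix_inv_def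
    by (intro someI[where P = "\<lambda>C. A ** C = mat 1 \<and> C ** A = mat 1" and x = B]) blast
  then show ?thesis
    by (metis \<open>B ** A = mat 1\<close> matrix_mul_assoc matrix_mul_lid matrix_mul_rid)
qed

context weighted_digraph
begin

lemma adjacency_nonneg: "0 \<le> adjacency E w $ i $ j"
  using weight_pos by (auto simp: adjacency_def raw_adjacency_def less_imp_le)

text \<open>The unit put on the diagonal of an empty row is what makes every degree positive.\<close>

lemma degree_pos: "0 < (\<Sum>j\<in>UNIV. adjacency E w $ i $ j)"
proof -
  have "\<exists>j. adjacency E w $ i $ j \<noteq> 0"
  proof (cases "raw_adjacency E w $ i = 0")
    case True
    then show ?thesis by (auto simp: adjacency_def intro!: exI[of _ i])
  next
    case False
    then show ?thesis by (auto simp: adjacency_def vec_eq_iff)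
  qed
  then obtain j where "0 < adjacency E w $ i $ j"
    using adjacency_nonneg[of i] by (metis order_less_le)
  then show ?thesis
    using adjacency_nonneg by (intro sum_pos2[of _ j]) auto
qed

lemma transition_matrix_nth:
  "transition_matrix E w $ i $ j
     = adjacency E w $ i $ j / (\<Sum>v\<in>UNIV. adjacency E w $ i $ v)"
proof -
  let ?d = "\<lambda>i. \<Sum>v\<in>UNIV. adjacency E w $ i $ v"
  let ?B = "(\<chi> i j. if i = j then 1 / ?d i else 0) :: real^'n^'n"
  have d: "?d i \<noteq> 0" for i
    using degree_pos[of i] by simp
  have "degree_matrix E w ** ?B = mat 1"
    unfolding degree_matrix_def matrix_matrix_mult_def mat_def
    by (simp add: vec_eq_iff mult_delta_left d)
  then have "matrix_inv (degree_matrix E w) = ?B"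
    by (rule matrix_inv_eqI)
  then show ?thesis
    unfolding transition_matrix_def by (simp add: matrix_matrix_mult_def mult_delta_left)
qed

lemma row_stochastic_transition_matrix: "row_stochastic (transition_matrix E w)"
proof -
  have "0 \<le> transition_matrix E w $ i $ j" for i j
    unfolding transition_matrix_nth
    by (intro divide_nonneg_pos adjacency_nonneg degree_pos)
  moreover have "(\<Sum>j\<in>UNIV. transition_matrix E w $ i $ j) = 1" for i
    unfolding transition_matrix_nth sum_divide_distrib[symmetric]
    using degree_pos[of i] by simp
  ultimately show ?thesis
    by (simp add: row_stochastic_def)
qed

end

section \<open>Roots of reaches and biorthogonality of the kernel bases\<close>

lemma reachable_set_mono:
  assumes "r \<in> reachable_set E j"
  shows "reachable_set E r \<subseteq> reachable_set E j"
  using assms by (auto simp: reachable_set_def)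

text \<open>
  A reach containing a root of \<open>X\<close> contains everything reachable from that root, hence all of \<open>X\<close>;
  by maximality it is \<open>X\<close>.
\<close>

lemma root_in_unique_reach:
  assumes X: "X \<in> reaches E" and Y: "Y \<in> reaches E"
    and r: "r \<in> cabal E X" "r \<in> Y"
  shows "Y = X"
proof -
  obtain j where j: "Y = reachable_set E j"
    using Y by (auto simp: reaches_def)
  have "X \<subseteq> Y"
    using reachable_set_mono[of r E j] r j by (auto simp: cabal_def)
  then show ?thesis
    using X Y by (auto simp: reaches_def)
qed

lemma cabal_subset_exclusive_part:
  assumes "X \<in> reaches E"
  shows "cabal E X \<subseteq> exclusive_part E X"
proof
  fix r assume "r \<in> cabal E X"
  then show "r \<in> exclusive_part E X"
    using root_in_unique_reach[OF assms] by (auto simp: exclusive_part_def cabal_def)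
qed

lemma kernel_bases_biorthogonal:
  fixes E :: "('n::finite \<times> 'n) set" and \<gamma> \<gamma>' :: "nat \<Rightarrow> real^'n"
  assumes R: "bij_betw R {1..k} (reaches E)"
    and \<gamma>: "right_kernel_basis E w k R \<gamma>"
    and \<gamma>': "left_kernel_basis E w k R \<gamma>'"
    and m: "m \<in> {1..k}" and j: "j \<in> {1..k}"
  shows "\<gamma>' m \<bullet> \<gamma> j = (if m = j then 1 else 0)"
proof -
  have reach: "R i \<in> reaches E" if "i \<in> {1..k}" for i
    using R that by (auto simp: bij_betw_def)
  have supp: "{v. \<gamma>' m $ v \<noteq> 0} = cabal E (R m)" and total: "(\<Sum>v\<in>UNIV. \<gamma>' m $ v) = 1"
    using \<gamma>' m by (auto simp: left_kernel_basis_def)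
  have on_root: "\<gamma> j $ v = (if m = j then 1 else 0)" if "v \<in> cabal E (R m)" for v
  proof (cases "m = j")
    case True
    then show ?thesis
      using \<gamma> m that cabal_subset_exclusive_part[OF reach[OF m]]
      by (auto simp: right_kernel_basis_def)
  next
    case False
    then have "R j \<noteq> R m"
      using R m j by (metis bij_betw_def inj_onD)
    then have "v \<notin> R j"
      using root_in_unique_reach[OF reach[OF m] reach[OF j] that] by blast
    then show ?thesis
      using \<gamma> j False by (auto simp: right_kernel_basis_def)
  qed
  have "\<gamma>' m $ v * \<gamma> j $ v = \<gamma>' m $ v * (if m = j then 1 else 0)" for v
  proof (cases "v \<in> cabal E (R m)")
    case True
    then show ?thesis by (simp only: on_root)
  next
    case False
    then have "\<gamma>' m $ v = 0" using supp by blast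
    then show ?thesis by simp
  qed
  then have "\<gamma>' m \<bullet> \<gamma> j = (\<Sum>v\<in>UNIV. \<gamma>' m $ v * (if m = j then 1 else 0))"
    by (simp only: inner_vec_def inner_real_def)
  then show ?thesis
    using total by (cases "m = j") simp_all
qed

section \<open>The limit of the random walk averages\<close>

theorem theorem5p2:
  fixes E :: "('n::finite \<times> 'n) set"
    and w :: "'n \<Rightarrow> 'n \<Rightarrow> real"
    and k :: nat
    and R :: "nat \<Rightarrow> 'n set"
    and \<gamma> \<gamma>' :: "nat \<Rightarrow> real^'n"
    and p0 :: "real^'n"
  assumes "weighted_digraph E w"
    and "bij_betw R {1..k} (reaches E)"
    and "right_kernel_basis E w k R \<gamma>"
    and "left_kernel_basis E w k R \<gamma>'"
    and "\<And>v. p0 $ v \<ge> 0"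
    and "(\<Sum>v\<in>UNIV. p0 $ v) = 1"
  shows "(\<lambda>l. (1 / real l) *\<^sub>R (\<Sum>i<l. p0 v* mat_pow (transition_matrix E w) i))
           \<longlonglongrightarrow> (\<Sum>m=1..k. (p0 \<bullet> \<gamma> m) *\<^sub>R \<gamma>' m)"
proof -
  interpret weighted_digraph E w by fact
  let ?S = "transition_matrix E w" and ?L = "rw_laplacian E w"
  define q where "q = (\<Sum>m=1..k. (p0 \<bullet> \<gamma> m) *\<^sub>R \<gamma>' m)"
  have left_L: "x v* ?L = x - x v* ?S" for x
    by (simp add: rw_laplacian_def vector_matrix_mult_diff_rdistrib)
  have right_span: "span (\<gamma> ` {1..k}) = {x. ?L *v x = 0}"
    and left_span: "span (\<gamma>' ` {1..k}) = {p. p v* ?L = 0}"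
    using assms(3,4) by (simp_all add: right_kernel_basis_def left_kernel_basis_def basis_family_def)

  have "q \<in> span (\<gamma>' ` {1..k})"
    unfolding q_def by (intro span_sum span_scale span_base) auto
  then have stationary: "q v* ?S = q"
    using left_span left_L by auto

  have orth: "(p0 - q) \<bullet> \<gamma> j = 0" if "j \<in> {1..k}" for j
  proof -
    have "q \<bullet> \<gamma> j = (\<Sum>m=1..k. (p0 \<bullet> \<gamma> m) * (if m = j then 1 else 0))"
      unfolding q_def inner_sum_left inner_scaleR_left
      by (intro sum.cong refl) (simp add: kernel_bases_biorthogonal[OF assms(2-4) _ that])
    also have "\<dots> = p0 \<bullet> \<gamma> j"
      using that by (simp add: if_distrib cong: if_cong)
    finally show ?thesis
      by (simp add: inner_diff_left)
  qed
  have "(p0 - q) \<bullet> x = 0" if "?L *v x = 0" for x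
  proof -
    have "x \<in> span (\<gamma> ` {1..k})"
      using that right_span by simp
    then have "orthogonal (p0 - q) x"
      by (rule orthogonal_to_span) (use orth in \<open>auto simp: orthogonal_def\<close>)
    then show ?thesis
      by (simp add: orthogonal_def)
  qed
  then obtain y where "p0 - q = y v* ?L"
    using orthogonal_right_kernel_in_row_space by blast
  then have "p0 = q + (y - y v* ?S)"
    by (metis left_L add.commute diff_add_cancel)
  then show ?thesis
    unfolding q_def[symmetric]
    by (rule cesaro_mean_tendsto_stationary_part[OF row_stochastic_transition_matrix stationary])
qed

end
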